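(* Let $\xi_1,\xi_2,\ldots$ be independent real-valued random variables, and let $\eta$ be a counting random variable independent of $\{\xi_1,\xi_2,\ldots\}$. Suppose that the following conditions are satisfied: (a) $F_{\xi_1}\in\mathcal{C}$; (b) for each $k\geqslant2$, either $F_{\xi_k}\in\mathcal{C}$ or $\overline{F}_{\xi_k}(x)=o\left(\overline{F}_{\xi_1}(x)\right)$ as $x\to\infty$; (c) $\displaystyle\limsup_{x\to\infty}\,\sup_{n\geqslant1}\frac{1}{n\,\overline{F}_{\xi_1}(x)}\sum_{i=1}^{n}\overline{F}_{\xi_i}(x)<\infty$; (d) $\mathbb{E}\,\eta^{p+1}<\infty$ for some $p>J^{+}_{F_{\xi_1}}$. Then the distribution function $F_{S_\eta}$ of the randomly stopped sum $S_\eta$ belongs to the class $\mathcal{C}$.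
   Context: For a random variable $X$, $F_X(x)=\mathbb{P}(X\leqslant x)$ denotes its distribution function (d.f.), and for a d.f. $F$, $\overline{F}(x)=1-F(x)$ for real $x$. A counting random variable is an integer-valued, nonnegative random variable that is nondegenerate at zero (i.e. $\mathbb{P}(\eta=0)<1$). Put $S_0=0$, $S_n=\xi_1+\cdots+\xi_n$ for $n\in\mathbb{N}$, and $S_\eta=\sum_{k=1}^{\eta}\xi_k$, so that $F_{S_\eta}(x)=\sum_{n=0}^{\infty}\mathbb{P}(\eta=n)\mathbb{P}(S_n\leqslant x)$. Class $\mathcal{C}$: a d.f. $F$ on $\mathbb{R}$ (with $\overline{F}(x)>0$ for all $x$, so that the ratio is defined) has a consistently varying tail, written $F\in\mathcal{C}$, if $$\lim_{y\uparrow1}\limsup_{x\to\infty}\frac{\overline{F}(xy)}{\overline{F}(x)}=1.$$ The upper Matuszewska index of a d.f. $F$ is $$J_F^+=-\lim_{y\to\infty}\frac{1}{\log y}\log\left(\liminf_{x\to\infty}\frac{\overline{F}(xy)}{\overline{F}(x)}\right).$$ The notation $f(x)=o(g(x))$ means $\lim_{x\to\infty}f(x)/g(x)=0$. *)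

theory Defs
  imports "HOL-Probability.Probability"
begin

definition tail :: "(real \<Rightarrow> real) \<Rightarrow> real \<Rightarrow> real" where
  "tail F x = 1 - F x"

definition rv_df :: "'a measure \<Rightarrow> ('a \<Rightarrow> real) \<Rightarrow> real \<Rightarrow> real" where
  "rv_df M X = cdf (distr M borel X)"

definition consistently_varying :: "(real \<Rightarrow> real) \<Rightarrow> bool" where
  "consistently_varying F \<longleftrightarrow>
     (\<forall>x. tail F x > 0) \<and>
     ((\<lambda>y. Limsup at_top (\<lambda>x. ereal (tail F (x * y) / tail F x))) \<longlongrightarrow> 1) (at_left 1)"

(* Logarithm of an extended nonnegative real: log 0 = -\<infinity>, so that the index below is
   \<infinity> (and not 0, as the real function ln would give) when the lower limits vanish. *)
definition ereal_log :: "ereal \<Rightarrow> ereal" where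
  "ereal_log u = (if u \<le> 0 then -\<infinity> else if u = \<infinity> then \<infinity> else ereal (ln (real_of_ereal u)))"

(* For a distribution function F with positive tail, minus the log of the lower limit is
   a monotone subadditive function of ln y, so the limit always exists in ereal. *)
definition upper_Matuszewska_index :: "(real \<Rightarrow> real) \<Rightarrow> ereal" where
  "upper_Matuszewska_index F =
     - Lim at_top (\<lambda>y::real. ereal (1 / ln y) *
         ereal_log (Liminf at_top (\<lambda>x::real. ereal (tail F (x * y) / tail F x))))"

(* indep_var only relates random variables with the same codomain type; this is independence
   of the generated sigma-algebras. *)
definition independent_rvs ::
    "'a measure \<Rightarrow> 'b measure \<Rightarrow> ('a \<Rightarrow> 'b) \<Rightarrow> 'c measure \<Rightarrow> ('a \<Rightarrow> 'c) \<Rightarrow> bool" where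
  "independent_rvs M N X L Y \<longleftrightarrow>
     X \<in> measurable M N \<and> Y \<in> measurable M L \<and>
     prob_space.indep_set M (sets (vimage_algebra (space M) X N))
       (sets (vimage_algebra (space M) Y L))"

definition random_sum :: "(nat \<Rightarrow> 'a \<Rightarrow> real) \<Rightarrow> ('a \<Rightarrow> nat) \<Rightarrow> 'a \<Rightarrow> real" where
  "random_sum \<xi> \<eta> \<omega> = (\<Sum>k = 1..\<eta> \<omega>. \<xi> k \<omega>)"

end

theory Submission
  imports Defs
begin

text \<open>
  Write \<open>g\<close> for the tail of \<open>\<xi> 1\<close>, \<open>s n\<close> for the tail of \<open>\<xi> 1 + \<dots> + \<xi> n\<close> and \<open>T\<close> for the tail of
  the random sum. By independence of \<open>\<eta>\<close> and the sequence, \<open>T x\<close> is the mixture of the \<open>s n x\<close> with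
  weights \<open>P(\<eta> = n)\<close> (\<open>tail_random_sum_sums\<close>). The proof has three ingredients.

  First, every single \<open>s n\<close> with \<open>n \<ge> 1\<close> is consistently varying and dominates \<open>g\<close> up to a constant
  (\<open>tail_partial_sum_decay\<close>). This is an induction on \<open>n\<close>: for independent \<open>X\<close>, \<open>Y\<close> with tails
  \<open>f\<close>, \<open>h\<close> such that \<open>f + h\<close> varies consistently, \<open>X + Y\<close> is large essentially only if one of the
  two terms is, so that the tail of \<open>X + Y\<close> is asymptotic to \<open>f + h\<close> (\<open>tail_add_asymp\<close>).

  Secondly, there is a constant \<open>C\<close> with \<open>s n x \<le> C * n powr (p + 1) * g x\<close> for all large \<open>x\<close> and
  \<^emph>\<open>all\<close> \<open>n\<close> (\<open>tail_partial_sum_uniform_bound\<close>). If the sum of \<open>n\<close> terms exceeds \<open>x\<close>, then some term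
  exceeds \<open>x / n\<close>, and the average condition bounds \<open>s n x\<close> by a multiple of \<open>n * g (x / n)\<close>. Since \<open>p\<close>
  exceeds the upper Matuszewska index, \<open>g (x / n)\<close> is at most a multiple of \<open>n powr p * g x\<close>. When
  \<open>x / n\<close> is too small for these bounds, the same power bound shows that \<open>n powr p * g x\<close> is
  bounded away from \<open>0\<close>, so that the trivial estimate \<open>s n x \<le> 1\<close> suffices.

  Thirdly, since \<open>\<eta>\<close> has a moment of order \<open>p + 1\<close>, the part of the mixture with \<open>n \<ge> N\<close> is at most
  an arbitrarily small multiple of \<open>g\<close>, hence of \<open>T\<close>, and the finitely many remaining terms share
  a common scaling factor close to \<open>1\<close> (\<open>consistent_decay_mixture\<close>).
\<close>

section \<open>Consistent decay of nonincreasing functions\<close>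

text \<open>
  For nonincreasing \<open>f\<close> the ratio \<open>f (x * y) / f x\<close> is, at positive \<open>x\<close>, at least \<open>1\<close> for \<open>y < 1\<close> and
  nonincreasing in \<open>y\<close>, so the iterated limit that defines a consistently varying tail reduces to the existence of a single
  suitable \<open>y\<close> for each \<open>e\<close>. The product form makes sense also where \<open>f\<close> vanishes, so that
  empty sums and the tail of the constant \<open>0\<close> are covered.
\<close>

definition consistent_decay :: "(real \<Rightarrow> real) \<Rightarrow> bool" where
  "consistent_decay f \<longleftrightarrow>
     (\<forall>e>0. \<exists>y. 0 < y \<and> y < 1 \<and> (\<forall>\<^sub>F x in at_top. f (x * y) \<le> (1 + e) * f x))"

lemma eventually_at_top_scale:
  fixes c :: real
  assumes "0 < c" "eventually P at_top"
  shows "\<forall>\<^sub>F x in at_top. P (x * c)"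
proof -
  have "filterlim (\<lambda>x. x * c) at_top at_top"
    by (rule filterlim_at_top_mult_tendsto_pos[OF tendsto_const assms(1) filterlim_ident])
  then show ?thesis
    using assms(2) by (rule eventually_compose_filterlim[rotated])
qed

lemma consistent_decayE:
  assumes "consistent_decay f" "antimono f" "0 < e"
  obtains y0 where "0 < y0" "y0 < 1"
    "\<And>y. y0 \<le> y \<Longrightarrow> \<forall>\<^sub>F x in at_top. f (x * y) \<le> (1 + e) * f x"
proof -
  from assms obtain y0 where y0: "0 < y0" "y0 < 1"
    and ev: "\<forall>\<^sub>F x in at_top. f (x * y0) \<le> (1 + e) * f x"
    unfolding consistent_decay_def by blast
  have "\<forall>\<^sub>F x in at_top. f (x * y) \<le> (1 + e) * f x" if "y0 \<le> y" for y
    using ev eventually_gt_at_top[of 0]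
  proof eventually_elim
    case (elim x)
    then have "f (x * y) \<le> f (x * y0)"
      using that by (intro antimonoD[OF assms(2)] mult_left_mono) auto
    with elim show ?case by linarith
  qed
  with y0 show ?thesis by (rule that)
qed

lemma consistent_decay_add:
  assumes "consistent_decay f" "antimono f" "consistent_decay h" "antimono h"
  shows "consistent_decay (\<lambda>x. f x + h x)"
  unfolding consistent_decay_def
proof (intro allI impI)
  fix e :: real assume e: "0 < e"
  obtain y1 where y1: "0 < y1" "y1 < 1"
    "\<And>y. y1 \<le> y \<Longrightarrow> \<forall>\<^sub>F x in at_top. f (x * y) \<le> (1 + e) * f x"
    using consistent_decayE[OF assms(1,2) e] by metis
  obtain y2 where y2: "0 < y2" "y2 < 1"
    "\<And>y. y2 \<le> y \<Longrightarrow> \<forall>\<^sub>F x in at_top. h (x * y) \<le> (1 + e) * h x"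
    using consistent_decayE[OF assms(3,4) e] by metis
  have "\<forall>\<^sub>F x in at_top. f (x * max y1 y2) + h (x * max y1 y2) \<le> (1 + e) * (f x + h x)"
    using y1(3)[OF max.cobounded1[of y1 y2]] y2(3)[OF max.cobounded2[of y2 y1]]
    by eventually_elim (simp add: algebra_simps)
  then show "\<exists>y>0. y < 1 \<and> (\<forall>\<^sub>F x in at_top. f (x * y) + h (x * y) \<le> (1 + e) * (f x + h x))"
    using y1 y2 by (intro exI[of _ "max y1 y2"]) auto
qed

lemma consistent_decay_cmult:
  assumes "consistent_decay f" "0 \<le> c"
  shows "consistent_decay (\<lambda>x. c * f x)"
  unfolding consistent_decay_def
proof (intro allI impI)
  fix e :: real assume e: "0 < e"
  then obtain y where y: "0 < y" "y < 1" "\<forall>\<^sub>F x in at_top. f (x * y) \<le> (1 + e) * f x"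
    using assms(1) unfolding consistent_decay_def by blast
  from y(3) have "\<forall>\<^sub>F x in at_top. c * f (x * y) \<le> (1 + e) * (c * f x)"
    by eventually_elim (use assms(2) in \<open>metis mult_left_mono mult.left_commute\<close>)
  then show "\<exists>y>0. y < 1 \<and> (\<forall>\<^sub>F x in at_top. c * f (x * y) \<le> (1 + e) * (c * f x))"
    using y by blast
qed

lemma consistent_decay_sum:
  assumes "finite A" "\<And>i. i \<in> A \<Longrightarrow> consistent_decay (f i)" "\<And>i. i \<in> A \<Longrightarrow> antimono (f i)"
  shows "consistent_decay (\<lambda>x. \<Sum>i\<in>A. f i x)"
  using assms
proof (induction A rule: finite_induct)
  case empty
  show ?case
    unfolding consistent_decay_def by (auto intro!: exI[of _ "1/2"])
next
  case (insert a A)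
  have "consistent_decay (\<lambda>x. f a x + (\<Sum>i\<in>A. f i x))"
    using insert by (intro consistent_decay_add) (auto simp: antimono_def intro!: sum_mono)
  with insert show ?case by simp
qed

text \<open>
  Two factors \<open>1 + d\<close> and one factor \<open>1 - d\<close> are lost in passing from \<open>T\<close> to \<open>H\<close> and back.
\<close>

lemma consistent_decay_asymp:
  assumes H: "consistent_decay H" and T0: "\<And>x. 0 \<le> T x"
    and up: "\<And>e. 0 < e \<Longrightarrow> \<forall>\<^sub>F x in at_top. T x \<le> (1 + e) * H x"
    and low: "\<And>e. 0 < e \<Longrightarrow> \<forall>\<^sub>F x in at_top. (1 - e) * H x \<le> T x"
  shows "consistent_decay T"
  unfolding consistent_decay_def
proof (intro allI impI)
  fix e :: real assume e: "0 < e"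
  \<comment> \<open>small enough that \<open>(1 + d)\<^sup>2 / (1 - d) \<le> 1 + e\<close>\<close>
  define d where "d = min (e / 10) (1 / 10)"
  have d: "0 < d" "d \<le> 1/10" "d \<le> e / 10" using e by (auto simp: d_def)
  obtain y where y: "0 < y" "y < 1" "\<forall>\<^sub>F x in at_top. H (x * y) \<le> (1 + d) * H x"
    using H d unfolding consistent_decay_def by blast
  have const: "(1 + d) * (1 + d) \<le> (1 + e) * (1 - d)"
  proof -
    have "d * d \<le> d * (1/10)" "e * d \<le> e * (1/10)"
      using d e by (intro mult_left_mono; simp)+
    moreover have "(1 + d) * (1 + d) = 1 + 2 * d + d * d" "(1 + e) * (1 - d) = 1 + e - d - e * d"
      by (simp_all add: algebra_simps)
    ultimately show ?thesis using d by linarith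
  qed
  have "\<forall>\<^sub>F x in at_top. T (x * y) \<le> (1 + e) * T x"
    using y(3) eventually_at_top_scale[OF y(1) up[OF d(1)]] low[OF d(1)] up[OF d(1)]
  proof eventually_elim
    case (elim x)
    have "0 \<le> (1 + d) * H x" using elim T0[of x] by linarith
    then have H0: "0 \<le> H x" using d by (simp add: zero_le_mult_iff)
    have "T (x * y) \<le> (1 + d) * H (x * y)" using elim by simp
    also have "\<dots> \<le> (1 + d) * ((1 + d) * H x)"
      using elim d by (intro mult_left_mono) auto
    also have "\<dots> = ((1 + d) * (1 + d)) * H x" by simp
    also have "\<dots> \<le> ((1 + e) * (1 - d)) * H x"
      using const H0 by (rule mult_right_mono)
    also have "\<dots> = (1 + e) * ((1 - d) * H x)" by simp
    also have "\<dots> \<le> (1 + e) * T x" using elim e by (intro mult_left_mono) auto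
    finally show ?case .
  qed
  with y show "\<exists>y>0. y < 1 \<and> (\<forall>\<^sub>F x in at_top. T (x * y) \<le> (1 + e) * T x)" by blast
qed

lemma consistent_decay_add_smallo:
  assumes f: "consistent_decay f" "\<And>x. 0 < f x" and h: "\<And>x. 0 \<le> h x" "h \<in> o[at_top](f)"
  shows "consistent_decay (\<lambda>x. f x + h x)"
proof (rule consistent_decay_asymp[OF f(1)])
  fix e :: real assume "0 < e"
  from landau_o.smallD[OF h(2) this]
  show "\<forall>\<^sub>F x in at_top. f x + h x \<le> (1 + e) * f x"
    by eventually_elim (use f h in \<open>simp add: algebra_simps abs_of_pos\<close>)
  show "\<forall>\<^sub>F x in at_top. (1 - e) * f x \<le> f x + h x"
  proof (intro always_eventually allI)
    fix x
    have "0 \<le> e * f x" using \<open>0 < e\<close> f(2)[of x] by simp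
    then show "(1 - e) * f x \<le> f x + h x" using h(1)[of x] by (simp add: algebra_simps)
  qed
qed (use f h in \<open>auto intro: add_nonneg_nonneg less_imp_le\<close>)

lemma consistently_varying_iff_consistent_decay:
  assumes mono: "antimono (tail F)"
  shows "consistently_varying F \<longleftrightarrow> (\<forall>x. 0 < tail F x) \<and> consistent_decay (tail F)"
proof -
  define R where "R = (\<lambda>y. Limsup at_top (\<lambda>x. ereal (tail F (x * y) / tail F x)))"
  have "(R \<longlongrightarrow> 1) (at_left 1) \<longleftrightarrow> consistent_decay (tail F)" if pos: "\<And>x. 0 < tail F x"
  proof
    assume lim: "(R \<longlongrightarrow> 1) (at_left 1)"
    show "consistent_decay (tail F)"
      unfolding consistent_decay_def
    proof (intro allI impI)
      fix e :: real assume e: "0 < e"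
      have "(1::ereal) < ereal (1 + e)" using e by (simp add: one_ereal_def)
      from order_tendstoD(2)[OF lim this]
      have "\<forall>\<^sub>F y in at_left 1. R y < ereal (1 + e)" .
      moreover have "\<forall>\<^sub>F y in at_left (1::real). y \<in> {0<..<1}"
        by (rule eventually_at_left_real) simp
      ultimately obtain y where y: "R y < ereal (1 + e)" "0 < y" "y < 1"
        using eventually_happens[OF eventually_conj] by fastforce
      from Limsup_lessD[OF y(1)[unfolded R_def]]
      have "\<forall>\<^sub>F x in at_top. tail F (x * y) \<le> (1 + e) * tail F x"
        by eventually_elim (use pos in \<open>simp add: divide_less_eq less_imp_le\<close>)
      with y show "\<exists>y>0. y < 1 \<and> (\<forall>\<^sub>F x in at_top. tail F (x * y) \<le> (1 + e) * tail F x)"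
        by blast
    qed
  next
    assume dec: "consistent_decay (tail F)"
    show "(R \<longlongrightarrow> 1) (at_left 1)"
    proof (rule order_tendstoI)
      fix a :: ereal assume a: "a < 1"
      have "1 \<le> R y" if "0 < y" "y < 1" for y
        unfolding R_def
      proof (rule le_Limsup)
        show "\<forall>\<^sub>F x in at_top. 1 \<le> ereal (tail F (x * y) / tail F x)"
          using eventually_gt_at_top[of 0]
        proof eventually_elim
          case (elim x)
          then have "tail F x \<le> tail F (x * y)"
            using that by (intro antimonoD[OF mono]) (simp add: mult_le_cancel_left2)
          then show ?case using pos[of x] by (simp add: one_ereal_def)
        qed
      qed simp
      moreover have "\<forall>\<^sub>F y in at_left (1::real). y \<in> {0<..<1}"
        by (rule eventually_at_left_real) simp
      ultimately show "\<forall>\<^sub>F y in at_left 1. a < R y"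
        using a by (auto elim!: eventually_mono intro: less_le_trans)
    next
      fix a :: ereal assume a: "1 < a"
      then obtain b :: real where b: "1 < ereal b" "ereal b < a"
        using ereal_dense2 by blast
      have "0 < b - 1" using b by (simp add: one_ereal_def)
      then obtain y0 where y0: "0 < y0" "y0 < 1"
        "\<And>y. y0 \<le> y \<Longrightarrow> \<forall>\<^sub>F x in at_top. tail F (x * y) \<le> (1 + (b - 1)) * tail F x"
        using consistent_decayE[OF dec mono] by metis
      have R_le: "R y \<le> ereal b" if "y0 \<le> y" for y
        unfolding R_def
      proof (rule Limsup_bounded)
        show "\<forall>\<^sub>F x in at_top. ereal (tail F (x * y) / tail F x) \<le> ereal b"
          using y0(3)[OF that] by eventually_elim (use pos in \<open>simp add: divide_le_eq\<close>)
      qed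
      have "\<forall>\<^sub>F y in at_left (1::real). y \<in> {y0<..<1}"
        by (rule eventually_at_left_real) (use y0 in simp)
      then show "\<forall>\<^sub>F y in at_left 1. R y < a"
      proof eventually_elim
        case (elim y)
        then show ?case using le_less_trans[OF R_le b(2), of y] by simp
      qed
    qed
  qed
  then show ?thesis
    unfolding consistently_varying_def R_def by blast
qed

section \<open>The upper Matuszewska index and power bounds\<close>

text \<open>
  Iterating the bound along the powers of \<open>y\<close> and rounding \<open>t\<close> up to the next power, which exceeds \<open>t\<close>
  at most by the factor \<open>y\<close>; this rounding costs the factor \<open>y powr (-q)\<close>.
\<close>

lemma power_bound_extend:
  fixes g :: "real \<Rightarrow> real"
  assumes mono: "antimono g" and pos: "\<And>x. 0 < g x" and y: "1 < y" and q: "0 \<le> q"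
    and x0: "0 < x0" and step: "\<And>x. x0 \<le> x \<Longrightarrow> y powr (-q) * g x \<le> g (x * y)"
    and t: "1 \<le> t" and x: "x0 \<le> x"
  shows "y powr (-q) * t powr (-q) * g x \<le> g (x * t)"
proof -
  have iter: "(y ^ k) powr (-q) * g x \<le> g (x * y ^ k)" for k
  proof (induction k)
    case (Suc k)
    have "x0 \<le> x * y ^ k"
      using x x0 y one_le_power[of y k] mult_left_mono[of 1 "y ^ k" x] by linarith
    note * = step[OF this]
    have "(y ^ Suc k) powr (-q) * g x = y powr (-q) * ((y ^ k) powr (-q) * g x)"
      using y by (simp add: powr_mult)
    also have "\<dots> \<le> y powr (-q) * g (x * y ^ k)"
      using Suc.IH by (intro mult_left_mono) auto
    also have "\<dots> \<le> g (x * y ^ k * y)" by (rule *)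
    finally show ?case by (simp add: mult_ac)
  qed simp
  obtain k where k: "t \<le> y ^ k" "y ^ k \<le> y * t"
  proof -
    define k where "k = (LEAST k. t \<le> y ^ k)"
    obtain n where "t < y ^ n" using real_arch_pow[OF y] by blast
    then have 1: "t \<le> y ^ k" unfolding k_def by (intro LeastI[where P = "\<lambda>k. t \<le> y ^ k" and k = n]) simp
    have "y ^ k \<le> y * t"
    proof (cases k)
      case 0
      then show ?thesis using y t mult_mono[of 1 y 1 t] by simp
    next
      case (Suc j)
      then have "\<not> t \<le> y ^ j" unfolding k_def by (metis lessI not_less_Least)
      with Suc y show ?thesis by simp
    qed
    with 1 show ?thesis by (rule that)
  qed
  have "y powr (-q) * t powr (-q) = (y * t) powr (-q)" using y t by (simp add: powr_mult)
  also have "\<dots> \<le> (y ^ k) powr (-q)" using k q y t by (intro powr_mono2') auto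
  finally have "y powr (-q) * t powr (-q) * g x \<le> (y ^ k) powr (-q) * g x"
    using pos[of x] by (intro mult_right_mono) auto
  also have "\<dots> \<le> g (x * y ^ k)" by (rule iter)
  also have "\<dots> \<le> g (x * t)"
    using k x x0 by (intro antimonoD[OF mono] mult_left_mono) auto
  finally show ?thesis .
qed

text \<open>
  A bound by the power \<open>q\<close> is demanded for one scale \<open>y\<close> only; iteration turns it into a bound for
  all scales. The upper Matuszewska index is the infimum of these exponents.
\<close>

definition decay_exponents :: "(real \<Rightarrow> real) \<Rightarrow> real set" where
  "decay_exponents g =
     {q. 0 \<le> q \<and> (\<exists>y>1. \<forall>\<^sub>F x in at_top. y powr (-q) * g x \<le> g (x * y))}"

lemma decay_exponents_power_bound:
  assumes mono: "antimono g" and pos: "\<And>x. 0 < g x" and q: "q \<in> decay_exponents g"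
  obtains c x0 where "0 < c" "0 < x0" "\<And>x t. x0 \<le> x \<Longrightarrow> 1 \<le> t \<Longrightarrow> c * t powr (-q) * g x \<le> g (x * t)"
proof -
  from q obtain y where q0: "0 \<le> q" and y: "1 < y"
    and "\<forall>\<^sub>F x in at_top. y powr (-q) * g x \<le> g (x * y)"
    unfolding decay_exponents_def by blast
  then obtain x1 where "\<And>x. x1 \<le> x \<Longrightarrow> y powr (-q) * g x \<le> g (x * y)"
    unfolding eventually_at_top_linorder by blast
  then have step: "\<And>x. max x1 1 \<le> x \<Longrightarrow> y powr (-q) * g x \<le> g (x * y)" by simp
  have "y powr (-q) * t powr (-q) * g x \<le> g (x * t)" if "max x1 1 \<le> x" "1 \<le> t" for x t
    using step that by (intro power_bound_extend[OF mono pos y q0, of "max x1 1"]) auto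
  then show ?thesis
    by (intro that[of "y powr (-q)" "max x1 1"]) (use y in auto)
qed

text \<open>
  Consistent decay gives a \<open>y < 1\<close> with \<open>g (x * y) \<le> 2 * g x\<close>, and \<open>q\<close> is chosen so that \<open>1 / y\<close> to the
  power \<open>-q\<close> is \<open>1 / 2\<close>.
\<close>

lemma decay_exponents_nonempty:
  assumes dec: "consistent_decay g"
  shows "decay_exponents g \<noteq> {}"
proof -
  obtain y where y: "0 < y" "y < 1" "\<forall>\<^sub>F x in at_top. g (x * y) \<le> (1 + 1) * g x"
    using dec[unfolded consistent_decay_def, rule_format, of 1] by auto
  define q where "q = ln 2 / ln (1 / y)"
  have ly: "0 < ln (1 / y)" using y by (intro ln_gt_zero) auto
  have q0: "0 \<le> q" unfolding q_def using ly by (intro divide_nonneg_pos) auto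
  have half: "(1 / y) powr (-q) = 1 / 2"
  proof -
    have "(1 / y) powr (-q) = exp (- ln 2)"
      using y ly by (simp add: powr_def q_def)
    also have "\<dots> = 1 / 2" by (simp add: exp_minus field_simps)
    finally show ?thesis .
  qed
  have "\<forall>\<^sub>F x in at_top. (1 / y) powr (-q) * g x \<le> g (x * (1 / y))"
  proof -
    have "\<forall>\<^sub>F x in at_top. g (x * (1 / y) * y) \<le> (1 + 1) * g (x * (1 / y))"
      by (rule eventually_at_top_scale[OF _ y(3)]) (use y in simp)
    then show ?thesis
      unfolding half by eventually_elim (use y in simp)
  qed
  moreover have "1 < 1 / y" using y by simp
  ultimately have "q \<in> decay_exponents g"
    unfolding decay_exponents_def using q0 by blast
  then show ?thesis by blast
qed

text \<open>
  Consistent decay implies dominated variation: the power bound, applied from \<open>x * c\<close> upwards to a point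
  beyond \<open>x\<close>, controls \<open>g\<close> at every scale \<open>c\<close>, and not only at those close to \<open>1\<close>.
\<close>

lemma consistent_decay_dominated:
  assumes dec: "consistent_decay g" and mono: "antimono g" and pos: "\<And>x. 0 < g x" and c: "0 < c"
  obtains K where "0 < K" "\<forall>\<^sub>F x in at_top. g (x * c) \<le> K * g x"
proof -
  obtain q where q: "q \<in> decay_exponents g" using decay_exponents_nonempty[OF dec] by blast
  obtain a x0 where a: "0 < a" "0 < x0"
    "\<And>x t. x0 \<le> x \<Longrightarrow> 1 \<le> t \<Longrightarrow> a * t powr (-q) * g x \<le> g (x * t)"
    using decay_exponents_power_bound[OF mono pos q] by metis
  define t where "t = max 1 (1 / c)"
  have t: "1 \<le> t" "1 \<le> c * t" using c unfolding t_def by (auto simp: max_def field_simps)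
  define b where "b = a * t powr (-q)"
  have b: "0 < b" using a t by (simp add: b_def)
  have "\<forall>\<^sub>F x in at_top. g (x * c) \<le> (1 / b) * g x"
    using eventually_at_top_scale[OF c eventually_ge_at_top[of x0]] eventually_gt_at_top[of 0]
  proof eventually_elim
    case (elim x)
    have "b * g (x * c) \<le> g (x * c * t)" unfolding b_def using a(3)[OF elim(1) t(1)] .
    also have "\<dots> \<le> g x"
      using elim t mult_left_mono[of 1 "c * t" x] by (intro antimonoD[OF mono]) (auto simp: mult.assoc)
    finally show ?case using b by (simp add: field_simps)
  qed
  then show ?thesis using b that[of "1 / b"] by simp
qed

text \<open>
  In the limit that defines the index, let \<open>m t\<close> be minus the logarithm of the lower limit of
  \<open>g (x * t) / g x\<close>. Every decay exponent \<open>q\<close> gives \<open>m t \<le> q * ln t + const\<close>, so the upper limit of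
  \<open>m t / ln t\<close> is at most the infimum of the exponents. Conversely, whenever \<open>m t / ln t < b\<close> for
  some \<open>t > 1\<close>, the number \<open>b\<close> is itself a decay exponent, so \<open>m t / ln t\<close> never falls below the infimum.
  In particular the limit exists, as the use of \<open>Lim\<close> in the definition of the index requires.
\<close>

lemma upper_Matuszewska_index_eq_Inf:
  assumes mono: "antimono (tail F)" and pos: "\<And>x. 0 < tail F x" and dec: "consistent_decay (tail F)"
  shows "upper_Matuszewska_index F = ereal (Inf (decay_exponents (tail F)))"
proof -
  define g where "g = tail F"
  define Q where "Q = decay_exponents g"
  define L where "L = Inf Q"
  define l where "l = (\<lambda>t. Liminf at_top (\<lambda>x. ereal (g (x * t) / g x)))"
  define m where "m = (\<lambda>t. - ln (real_of_ereal (l t)))"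
  have mono: "antimono g" and pos: "\<And>x. 0 < g x" and Q: "Q \<noteq> {}"
    using assms decay_exponents_nonempty by (auto simp: g_def Q_def)
  have Q0: "0 \<le> q" if "q \<in> Q" for q using that by (simp add: Q_def decay_exponents_def)
  then have bdd: "bdd_below Q" by (auto simp: bdd_below_def)
  have L0: "0 \<le> L" unfolding L_def using Q Q0 by (intro cInf_greatest) auto
  have l_le: "l t \<le> 1" if "1 \<le> t" for t
  proof -
    have "\<forall>\<^sub>F x in at_top. ereal (g (x * t) / g x) \<le> 1"
      using eventually_gt_at_top[of 0]
    proof eventually_elim
      case (elim x)
      then have "g (x * t) \<le> g x" using that by (intro antimonoD[OF mono]) simp
      then show ?case using pos[of x] by (simp add: one_ereal_def)
    qed
    then have "l t \<le> Liminf at_top (\<lambda>x::real. 1::ereal)" unfolding l_def by (rule Liminf_mono)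
    then show ?thesis by (simp add: Liminf_const)
  qed
  have l_ge: "\<exists>c>0. \<forall>t\<ge>1. ereal (c * t powr (-q)) \<le> l t" if q: "q \<in> Q" for q
  proof -
    obtain c x0 where c: "0 < c" "0 < x0"
      "\<And>x t. x0 \<le> x \<Longrightarrow> 1 \<le> t \<Longrightarrow> c * t powr (-q) * g x \<le> g (x * t)"
      using decay_exponents_power_bound[OF mono pos q[unfolded Q_def]] by metis
    have "ereal (c * t powr (-q)) \<le> l t" if "1 \<le> t" for t
      unfolding l_def
    proof (rule Liminf_bounded)
      show "\<forall>\<^sub>F x in at_top. ereal (c * t powr - q) \<le> ereal (g (x * t) / g x)"
        using eventually_ge_at_top[of x0]
        by eventually_elim (use c(3) that pos in \<open>simp add: le_divide_eq\<close>)
    qed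
    with c(1) show ?thesis by blast
  qed
  have l_real: "\<exists>r. l t = ereal r \<and> 0 < r \<and> r \<le> 1 \<and> m t = - ln r" if t: "1 \<le> t" for t
  proof -
    obtain q c where "q \<in> Q" "0 < c" "ereal (c * t powr (-q)) \<le> l t"
      using Q l_ge t by (metis ex_in_conv)
    moreover have "0 < c * t powr (-q)" using \<open>0 < c\<close> t by simp
    ultimately show ?thesis using l_le[OF t] unfolding m_def by (cases "l t") auto
  qed
  have upper: "m t \<le> q * ln t - ln c"
    if t: "1 \<le> t" "0 < c" "ereal (c * t powr (-q)) \<le> l t" for t q c
  proof -
    obtain r where r: "l t = ereal r" "0 < r" "m t = - ln r" using l_real t(1) by blast
    then have "c * t powr (-q) \<le> r" using t by simp
    then have "ln (c * t powr (-q)) \<le> ln r" using t r by (intro ln_mono) auto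
    then show ?thesis using t r by (simp add: ln_mult ln_powr)
  qed
  have lim: "((\<lambda>t. m t / ln t) \<longlongrightarrow> L) at_top"
  proof (rule order_tendstoI)
    fix a assume "L < a"
    then obtain q where q: "q \<in> Q" "q < a" unfolding L_def using Q bdd by (auto simp: cInf_less_iff)
    obtain c where c: "0 < c" "\<And>t. 1 \<le> t \<Longrightarrow> ereal (c * t powr (-q)) \<le> l t" using l_ge[OF q(1)] by blast
    have "((\<lambda>t. q - ln c / ln t) \<longlongrightarrow> q - 0) at_top"
      by (intro tendsto_intros real_tendsto_divide_at_top[OF tendsto_const] ln_at_top)
    then have "\<forall>\<^sub>F t in at_top. q - ln c / ln t < a" using q(2) by (intro order_tendstoD(2)) auto
    then show "\<forall>\<^sub>F t in at_top. m t / ln t < a"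
      using eventually_gt_at_top[of 1]
    proof eventually_elim
      case (elim t)
      then have "m t / ln t \<le> (q * ln t - ln c) / ln t"
        using upper[of t c q] c by (intro divide_right_mono) auto
      also have "\<dots> = q - ln c / ln t" using elim by (simp add: diff_divide_distrib)
      finally show ?case using elim by simp
    qed
  next
    fix a assume a: "a < L"
    show "\<forall>\<^sub>F t in at_top. a < m t / ln t"
      using eventually_gt_at_top[of 1]
    proof eventually_elim
      case (elim t)
      obtain r where r: "l t = ereal r" "0 < r" "r \<le> 1" "m t = - ln r"
        using l_real[of t] elim by auto
      have m0: "0 \<le> m t / ln t" using r elim by (intro divide_nonneg_pos) (auto simp: ln_le_zero_iff)
      show ?case
      proof (rule ccontr)
        assume neg: "\<not> a < m t / ln t"
        with m0 a have "0 < L" "0 \<le> a" by auto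
        \<comment> \<open>strictly above \<open>a\<close>, as only a strict bound on a lower limit holds eventually\<close>
        define b where "b = (a + L) / 2"
        have b: "a < b" "b < L" "0 \<le> b" using a \<open>0 \<le> a\<close> by (auto simp: b_def)
        have "m t < b * ln t" 
        proof -
          have "0 < ln t" using elim by simp
          then have "m t \<le> a * ln t" using neg by (simp add: not_less divide_le_eq)
          also have "\<dots> < b * ln t" using b(1) \<open>0 < ln t\<close> by (rule mult_strict_right_mono)
          finally show ?thesis .
        qed
        then have "ln (t powr (-b)) < ln r" using r elim by (simp add: ln_powr)
        then have "t powr (-b) < r"
          using r(2) elim by (subst (asm) ln_less_cancel_iff) auto
        then have "ereal (t powr (-b)) < l t" using r by simp
        from less_LiminfD[OF this[unfolded l_def]]
        have "\<forall>\<^sub>F x in at_top. t powr (-b) * g x \<le> g (x * t)"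
          by eventually_elim (use pos in \<open>simp add: less_divide_eq less_imp_le\<close>)
        then have "b \<in> Q" using b elim unfolding Q_def decay_exponents_def by blast
        then have "L \<le> b" unfolding L_def using bdd by (rule cInf_lower)
        with b show False by simp
      qed
    qed
  qed
  have "((\<lambda>t. ereal (1 / ln t) * ereal_log (l t)) \<longlongrightarrow> ereal (- L)) at_top"
  proof (rule Lim_transform_eventually)
    show "((\<lambda>t. ereal (- (m t / ln t))) \<longlongrightarrow> ereal (- L)) at_top"
      using lim by (intro tendsto_intros) auto
    show "\<forall>\<^sub>F t in at_top. ereal (- (m t / ln t)) = ereal (1 / ln t) * ereal_log (l t)"
      using eventually_gt_at_top[of 1]
    proof eventually_elim
      case (elim t)
      then show ?case using l_real[of t] by (auto simp: ereal_log_def)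
    qed
  qed
  then have "Lim at_top (\<lambda>t. ereal (1 / ln t) * ereal_log (l t)) = ereal (- L)"
    by (intro tendsto_Lim) auto
  then show ?thesis
    unfolding upper_Matuszewska_index_def l_def g_def L_def Q_def by simp
qed

section \<open>Mixtures of consistently decaying tails\<close>

text \<open>
  The terms \<open>n \<ge> N\<close> contribute at most \<open>d * g (x * y) \<le> 2 * d * g x\<close>, and \<open>g\<close> is at most a constant times
  \<open>T\<close> because the single term with index \<open>k\<close> dominates it. The terms \<open>n < N\<close> form a finite sum of
  consistently decaying functions.
\<close>

lemma consistent_decay_mixture:
  fixes s :: "nat \<Rightarrow> real \<Rightarrow> real" and p w :: "nat \<Rightarrow> real"
  assumes g: "consistent_decay g" "antimono g" "\<And>x. 0 < g x"
    and s: "\<And>n. consistent_decay (s n)" "\<And>n. antimono (s n)" "\<And>n x. 0 \<le> s n x"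
    and p: "\<And>n. 0 \<le> p n" and pw: "summable (\<lambda>n. p n * w n)"
    and dom: "\<forall>\<^sub>F x in at_top. \<forall>n. s n x \<le> w n * g x"
    and T: "\<And>x. (\<lambda>n. p n * s n x) sums T x"
    and k: "0 < p k" "g \<in> O[at_top](s k)"
  shows "consistent_decay T"
  unfolding consistent_decay_def
proof (intro allI impI)
  fix e :: real assume e: "0 < e"
  obtain K where K: "0 < K" "\<forall>\<^sub>F x in at_top. g x \<le> K * s k x"
    using k(2) g(3) s(3) by (auto elim!: landau_o.bigE simp: abs_of_nonneg less_imp_le)
  have terms: "0 \<le> p n * s n x" for n x using p s(3) by simp
  obtain y1 where y1: "0 < y1" "y1 < 1"
    "\<And>y. y1 \<le> y \<Longrightarrow> \<forall>\<^sub>F x in at_top. g (x * y) \<le> (1 + 1) * g x"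
    using consistent_decayE[OF g(1,2), of 1] by auto
  \<comment> \<open>chosen so that \<open>2 * d * g x \<le> (e / 2) * T x\<close>, given \<open>g x \<le> K / p k * T x\<close>\<close>
  define d where "d = e * p k / (4 * K)"
  have d: "0 < d" using e k K by (simp add: d_def)
  obtain N where N: "(\<Sum>n. p (n + N) * w (n + N)) < d"
    using suminf_exist_split[OF d pw] by (auto simp: abs_less_iff)
  define R where "R = (\<Sum>n. p (n + N) * w (n + N))"
  have "consistent_decay (\<lambda>x. \<Sum>n<N. p n * s n x)"
    by (intro consistent_decay_sum consistent_decay_cmult s p)
      (auto simp: antimono_def intro!: mult_left_mono p antimonoD[OF s(2)])
  moreover have "antimono (\<lambda>x. \<Sum>n<N. p n * s n x)"
    by (auto simp: antimono_def intro!: sum_mono mult_left_mono p antimonoD[OF s(2)])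
  ultimately obtain y2 where y2: "0 < y2" "y2 < 1"
    "\<And>y. y2 \<le> y \<Longrightarrow> \<forall>\<^sub>F x in at_top. (\<Sum>n<N. p n * s n (x * y)) \<le> (1 + e / 2) * (\<Sum>n<N. p n * s n x)"
    using e by (elim consistent_decayE[where e = "e / 2"]) auto
  define y where "y = max y1 y2"
  have y: "0 < y" "y < 1" "y1 \<le> y" "y2 \<le> y" using y1 y2 by (auto simp: y_def)
  have "\<forall>\<^sub>F x in at_top. T (x * y) \<le> (1 + e) * T x"
    using y1(3)[OF y(3)] y2(3)[OF y(4)] K(2) eventually_at_top_scale[OF y(1) dom]
  proof eventually_elim
    case (elim x)
    have head: "(\<Sum>n<N. p n * s n x) \<le> T x"
      using sum_le_suminf[OF sums_summable[OF T[of x]], of "{..<N}"] sums_unique[OF T[of x]] terms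
      by simp
    have "p k * s k x \<le> T x"
      using sum_le_suminf[OF sums_summable[OF T[of x]], of "{k}"] sums_unique[OF T[of x]] terms
      by simp
    then have gT: "g x \<le> K / p k * T x"
      using elim(3) k(1) K(1) mult_left_mono[of "p k * s k x" "T x" "K / p k"] by simp
    have "T (x * y) = (\<Sum>n. p (n + N) * s (n + N) (x * y)) + (\<Sum>n<N. p n * s n (x * y))"
      using suminf_split_initial_segment[OF sums_summable[OF T]] sums_unique[OF T] by metis
    also have "(\<Sum>n. p (n + N) * s (n + N) (x * y)) \<le> (\<Sum>n. p (n + N) * w (n + N) * g (x * y))"
    proof (rule suminf_le)
      show "p (n + N) * s (n + N) (x * y) \<le> p (n + N) * w (n + N) * g (x * y)" for n
        using elim(4) p[of "n + N"] by (metis mult.assoc mult_left_mono)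
      show "summable (\<lambda>n. p (n + N) * s (n + N) (x * y))"
        using sums_summable[OF T] by (rule summable_ignore_initial_segment)
      show "summable (\<lambda>n. p (n + N) * w (n + N) * g (x * y))"
        using pw by (intro summable_mult2 summable_ignore_initial_segment)
    qed
    also have "\<dots> = R * g (x * y)"
      unfolding R_def using summable_ignore_initial_segment[OF pw] by (rule suminf_mult2[symmetric])
    also have "\<dots> \<le> d * (2 * g x)"
      using elim(1) N d g(3)[of "x * y"] by (intro mult_mono) (auto simp: R_def)
    also have "\<dots> \<le> d * (2 * (K / p k * T x))" using gT d by (intro mult_left_mono) auto
    also have "\<dots> = e / 2 * T x" using k(1) K(1) by (simp add: d_def)
    also have "(\<Sum>n<N. p n * s n (x * y)) \<le> (1 + e / 2) * T x"
      by (rule order.trans[OF elim(2) mult_left_mono[OF head]]) (use e in simp)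
    finally show ?case by (simp add: algebra_simps)
  qed
  with y show "\<exists>y>0. y < 1 \<and> (\<forall>\<^sub>F x in at_top. T (x * y) \<le> (1 + e) * T x)" by blast
qed

section \<open>Tails of sums of independent random variables\<close>

context prob_space
begin

lemma tail_rv_df:
  assumes "random_variable borel X"
  shows "tail (rv_df M X) x = prob {\<omega> \<in> space M. x < X \<omega>}"
proof -
  have "prob {\<omega> \<in> space M. x < X \<omega>} = 1 - prob {\<omega> \<in> space M. X \<omega> \<le> x}"
    using assms by (subst prob_compl[symmetric]) (auto intro!: arg_cong[where f = prob])
  also have "{\<omega> \<in> space M. X \<omega> \<le> x} = X -` {..x} \<inter> space M" by auto
  finally show ?thesis
    unfolding tail_def rv_df_def cdf_def using assms by (simp add: measure_distr)
qed

lemma tail_rv_df_bounds: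
  assumes "random_variable borel X"
  shows "0 \<le> tail (rv_df M X) x" "tail (rv_df M X) x \<le> 1"
  by (simp_all add: tail_rv_df[OF assms])

lemma antimono_tail_rv_df:
  assumes "random_variable borel X"
  shows "antimono (tail (rv_df M X))"
proof (rule antimonoI)
  interpret D: real_distribution "distr M borel X" using assms by simp
  show "tail (rv_df M X) y \<le> tail (rv_df M X) x" if "x \<le> y" for x y
    unfolding tail_def rv_df_def using D.cdf_nondecreasing[OF that] by simp
qed

lemma tail_rv_df_at_top:
  assumes "random_variable borel X"
  shows "(tail (rv_df M X) \<longlongrightarrow> 0) at_top"
proof -
  interpret D: real_distribution "distr M borel X" using assms by simp
  show ?thesis
    unfolding tail_def[abs_def] rv_df_def using tendsto_diff[OF tendsto_const D.cdf_lim_at_top_prob, of 1]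
    by simp
qed

lemma tail_rv_df_at_bot:
  assumes "random_variable borel X"
  shows "(tail (rv_df M X) \<longlongrightarrow> 1) at_bot"
proof -
  interpret D: real_distribution "distr M borel X" using assms by simp
  show ?thesis
    unfolding tail_def[abs_def] rv_df_def using tendsto_diff[OF tendsto_const D.cdf_lim_at_bot, of 1]
    by simp
qed

lemma prob_joint_exceedance:
  assumes "indep_var borel X borel Y"
  shows "prob {\<omega> \<in> space M. a < X \<omega> \<and> b < Y \<omega>} = tail (rv_df M X) a * tail (rv_df M Y) b"
proof -
  have rv: "random_variable borel X" "random_variable borel Y"
    using assms indep_var_rv1 indep_var_rv2 by blast+
  have "{\<omega> \<in> space M. a < X \<omega> \<and> b < Y \<omega>} = (\<lambda>\<omega>. (X \<omega>, Y \<omega>)) -` ({a<..} \<times> {b<..}) \<inter> space M"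
    by auto
  then have "prob {\<omega> \<in> space M. a < X \<omega> \<and> b < Y \<omega>}
      = prob (X -` {a<..} \<inter> space M) * prob (Y -` {b<..} \<inter> space M)"
    using indep_varD[OF assms, of "{a<..}" "{b<..}"] by simp
  also have "X -` {a<..} \<inter> space M = {\<omega> \<in> space M. a < X \<omega>}" by auto
  also have "Y -` {b<..} \<inter> space M = {\<omega> \<in> space M. b < Y \<omega>}" by auto
  finally show ?thesis by (simp add: tail_rv_df rv)
qed

text \<open>
  If \<open>X + Y > x\<close> while neither term exceeds \<open>x * y\<close>, then both exceed \<open>x * (1 - y)\<close>.
\<close>

lemma tail_add_upper:
  assumes indep: "indep_var borel X borel Y"
  defines "f \<equiv> tail (rv_df M X)" and "h \<equiv> tail (rv_df M Y)"
  shows "tail (rv_df M (\<lambda>\<omega>. X \<omega> + Y \<omega>)) x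
    \<le> f (x * y) + h (x * y) + f (x * (1 - y)) * h (x * (1 - y))"
proof -
  have [measurable]: "random_variable borel X" "random_variable borel Y"
    using indep indep_var_rv1 indep_var_rv2 by blast+
  let ?A = "{\<omega> \<in> space M. x * y < X \<omega>}" and ?B = "{\<omega> \<in> space M. x * y < Y \<omega>}"
  let ?C = "{\<omega> \<in> space M. x * (1 - y) < X \<omega> \<and> x * (1 - y) < Y \<omega>}"
  have "tail (rv_df M (\<lambda>\<omega>. X \<omega> + Y \<omega>)) x = prob {\<omega> \<in> space M. x < X \<omega> + Y \<omega>}"
    by (rule tail_rv_df) simp
  also have "\<dots> \<le> prob (?A \<union> ?B \<union> ?C)"
    by (rule finite_measure_mono) (auto simp: algebra_simps)
  also have "\<dots> \<le> prob (?A \<union> ?B) + prob ?C"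
    by (rule measure_Un_le) auto
  also have "prob (?A \<union> ?B) \<le> prob ?A + prob ?B"
    by (rule measure_Un_le) auto
  also have "prob ?C = f (x * (1 - y)) * h (x * (1 - y))"
    unfolding f_def h_def by (rule prob_joint_exceedance[OF indep])
  finally show ?thesis by (simp add: f_def h_def tail_rv_df)
qed

text \<open>
  One term exceeds \<open>a\<close> while the other exceeds \<open>b\<close>; the two such events meet where both terms
  exceed \<open>a\<close>. The bound is used with a large \<open>a\<close> and a very negative \<open>b\<close>.
\<close>

lemma tail_add_lower:
  assumes indep: "indep_var borel X borel Y"
  defines "f \<equiv> tail (rv_df M X)" and "h \<equiv> tail (rv_df M Y)"
  assumes "a + b = x" "b \<le> a"
  shows "f a * h b + h a * f b - f a * h a \<le> tail (rv_df M (\<lambda>\<omega>. X \<omega> + Y \<omega>)) x"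
proof -
  have [measurable]: "random_variable borel X" "random_variable borel Y"
    using indep indep_var_rv1 indep_var_rv2 by blast+
  let ?A = "{\<omega> \<in> space M. a < X \<omega> \<and> b < Y \<omega>}" and ?B = "{\<omega> \<in> space M. b < X \<omega> \<and> a < Y \<omega>}"
  let ?C = "{\<omega> \<in> space M. a < X \<omega> \<and> a < Y \<omega>}"
  have AB: "?A \<inter> ?B = ?C" using \<open>b \<le> a\<close> by auto
  have "f a * h b + h a * f b - f a * h a = prob ?A + prob ?B - prob ?C"
    unfolding f_def h_def prob_joint_exceedance[OF indep] by simp
  also have "\<dots> = prob (?A \<union> ?B)"
    unfolding AB[symmetric] by (subst measure_Un3) (auto simp: fmeasurable_eq_sets)
  also have "\<dots> \<le> prob {\<omega> \<in> space M. x < X \<omega> + Y \<omega>}"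
    by (rule finite_measure_mono) (use \<open>a + b = x\<close> in auto)
  also have "\<dots> = tail (rv_df M (\<lambda>\<omega>. X \<omega> + Y \<omega>)) x"
    by (rule tail_rv_df[symmetric]) simp
  finally show ?thesis .
qed

text \<open>
  For the upper bound, scaling by a \<open>y\<close> close to \<open>1\<close> costs little by consistent decay, and the
  event that both terms are of order \<open>x\<close> has probability \<open>f (x * (1 - y)) * h (x * (1 - y))\<close>: the
  first factor is at most a multiple of \<open>f x + h x\<close> and the second tends to \<open>0\<close>. For the lower bound one
  term must exceed \<open>x / y\<close>, slightly more than \<open>x\<close>, while the other stays above the very
  negative value \<open>x - x / y\<close>, which happens with probability close to \<open>1\<close>.
\<close>

lemma tail_add_asymp:
  assumes indep: "indep_var borel X borel Y"
  defines "f \<equiv> tail (rv_df M X)" and "h \<equiv> tail (rv_df M Y)"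
  assumes dec: "consistent_decay (\<lambda>x. f x + h x)" and Hpos: "\<And>x. 0 < f x + h x" and e: "0 < e"
  shows "\<forall>\<^sub>F x in at_top. tail (rv_df M (\<lambda>\<omega>. X \<omega> + Y \<omega>)) x \<le> (1 + e) * (f x + h x)"
    and "\<forall>\<^sub>F x in at_top. (1 - e) * (f x + h x) \<le> tail (rv_df M (\<lambda>\<omega>. X \<omega> + Y \<omega>)) x"
proof -
  have rv: "random_variable borel X" "random_variable borel Y"
    using indep indep_var_rv1 indep_var_rv2 by blast+
  define H where "H = (\<lambda>x. f x + h x)"
  have f0: "0 \<le> f x" and h0: "0 \<le> h x" for x
    unfolding f_def h_def by (simp_all add: tail_rv_df_bounds rv)
  have mono: "antimono f" "antimono h"
    unfolding f_def h_def by (simp_all add: antimono_tail_rv_df rv)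
  have lim0: "(f \<longlongrightarrow> 0) at_top" "(h \<longlongrightarrow> 0) at_top"
    and lim1: "(f \<longlongrightarrow> 1) at_bot" "(h \<longlongrightarrow> 1) at_bot"
    unfolding f_def h_def by (simp_all add: tail_rv_df_at_top tail_rv_df_at_bot rv)
  have H: "consistent_decay H" "antimono H" and Hpos: "\<And>x. 0 < H x"
    using dec mono Hpos by (auto simp: H_def antimono_def add_mono)
  define d where "d = e / 2"
  have d: "0 < d" using e by (simp add: d_def)
  obtain y where y: "0 < y" "y < 1" "\<forall>\<^sub>F x in at_top. H (x * y) \<le> (1 + d) * H x"
    using H(1) d unfolding consistent_decay_def by blast
  obtain K where K: "0 < K" "\<forall>\<^sub>F x in at_top. H (x * (1 - y)) \<le> K * H x"
    using consistent_decay_dominated[OF H Hpos, of "1 - y"] y(2) by auto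
  have "\<forall>\<^sub>F x in at_top. h x < d / K"
    using lim0(2) by (rule order_tendstoD) (use d K in simp)
  then have small: "\<forall>\<^sub>F x in at_top. h (x * (1 - y)) < d / K"
    using y(2) by (intro eventually_at_top_scale) auto
  show "\<forall>\<^sub>F x in at_top. tail (rv_df M (\<lambda>\<omega>. X \<omega> + Y \<omega>)) x \<le> (1 + e) * (f x + h x)"
    using y(3) K(2) small
  proof eventually_elim
    case (elim x)
    have "tail (rv_df M (\<lambda>\<omega>. X \<omega> + Y \<omega>)) x \<le> H (x * y) + f (x * (1 - y)) * h (x * (1 - y))"
      using tail_add_upper[OF indep, of x y] by (simp add: f_def h_def H_def)
    also have "f (x * (1 - y)) * h (x * (1 - y)) \<le> (K * H x) * (d / K)"
    proof (intro mult_mono)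
      show "f (x * (1 - y)) \<le> K * H x"
        using elim(2) h0[of "x * (1 - y)"] unfolding H_def by linarith
    qed (use elim h0 K Hpos in \<open>auto intro: less_imp_le\<close>)
    also have "(K * H x) * (d / K) = d * H x" using K by simp
    also have "H (x * y) + d * H x \<le> (1 + d) * H x + d * H x" using elim by simp
    also have "\<dots> = (1 + e) * H x" by (simp add: d_def algebra_simps)
    finally show ?case by (simp add: H_def)
  qed
  have y1: "0 < 1 / y" using y by simp
  have neg: "filterlim (\<lambda>x. x * (1 - 1 / y)) at_bot at_top"
    using filterlim_tendsto_neg_mult_at_bot[OF tendsto_const _ filterlim_ident, of "1 - 1 / y"] y
    by (simp add: mult.commute)
  have near1: "\<forall>\<^sub>F x in at_top. 1 - d < f (x * (1 - 1 / y))"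
    using filterlim_compose[OF lim1(1) neg] by (rule order_tendstoD) (use d in simp)
  have near2: "\<forall>\<^sub>F x in at_top. 1 - d / 2 < h (x * (1 - 1 / y))"
    using filterlim_compose[OF lim1(2) neg] by (rule order_tendstoD) (use d in simp)
  have "\<forall>\<^sub>F x in at_top. h x < d / 2"
    using lim0(2) by (rule order_tendstoD) (use d in simp)
  note small2 = eventually_at_top_scale[OF y1 this]
  have const: "1 - e \<le> (1 - d) / (1 + d)"
    using d by (simp add: d_def field_simps)
  show "\<forall>\<^sub>F x in at_top. (1 - e) * (f x + h x) \<le> tail (rv_df M (\<lambda>\<omega>. X \<omega> + Y \<omega>)) x"
    using eventually_at_top_scale[OF y1 y(3)] near1 near2 small2 eventually_gt_at_top[of 0]
  proof eventually_elim
    case (elim x)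
    define u b where "u = x * (1 / y)" and "b = x * (1 - 1 / y)"
    have ub: "u + b = x" by (simp add: u_def b_def algebra_simps)
    have "b \<le> 0" "0 \<le> u"
      using elim(5) y by (auto simp: u_def b_def intro!: mult_nonneg_nonpos)
    then have "b \<le> u" by simp
    have "H x \<le> (1 + d) * H u" using elim(1) y by (simp add: u_def)
    show ?case
    proof (cases "d \<le> 1")
      case True
      have "(1 - e) * H x \<le> (1 - d) / (1 + d) * H x" 
        using const Hpos[of x] by (intro mult_right_mono) auto
      also have "\<dots> \<le> (1 - d) / (1 + d) * ((1 + d) * H u)"
        using \<open>H x \<le> (1 + d) * H u\<close> d True by (intro mult_left_mono) auto
      also have "\<dots> = (1 - d) * H u" using d by simp
      also have "\<dots> = f u * (1 - d) + h u * (1 - d)" by (simp add: H_def algebra_simps)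
      also have "\<dots> \<le> f u * (h b - h u) + h u * f b"
        using elim f0 h0 by (intro add_mono mult_left_mono) (auto simp: u_def b_def)
      also have "\<dots> \<le> tail (rv_df M (\<lambda>\<omega>. X \<omega> + Y \<omega>)) x"
        using tail_add_lower[OF indep ub \<open>b \<le> u\<close>] by (simp add: f_def h_def algebra_simps)
      finally show ?thesis by (simp add: H_def)
    next
      case False
      then have "(1 - e) * H x \<le> 0"
        using Hpos[of x] by (intro mult_nonpos_nonneg) (auto simp: d_def)
      also have "0 \<le> tail (rv_df M (\<lambda>\<omega>. X \<omega> + Y \<omega>)) x"
        using rv by (intro tail_rv_df_bounds) simp
      finally show ?thesis by (simp add: H_def)
    qed
  qed
qed

text \<open>
  If no summand exceeds the average \<open>x / card I\<close>, then the sum does not exceed \<open>x\<close>.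
\<close>

lemma tail_sum_le:
  assumes "finite I" "I \<noteq> {}" and rv: "\<And>i. i \<in> I \<Longrightarrow> random_variable borel (X i)"
  shows "tail (rv_df M (\<lambda>\<omega>. \<Sum>i\<in>I. X i \<omega>)) x \<le> (\<Sum>i\<in>I. tail (rv_df M (X i)) (x / card I))"
proof -
  have card: "0 < real (card I)" using assms(1,2) by (simp add: card_gt_0_iff)
  have "tail (rv_df M (\<lambda>\<omega>. \<Sum>i\<in>I. X i \<omega>)) x = prob {\<omega> \<in> space M. x < (\<Sum>i\<in>I. X i \<omega>)}"
    using rv by (intro tail_rv_df) simp
  also have "\<dots> \<le> prob (\<Union>i\<in>I. {\<omega> \<in> space M. x / card I < X i \<omega>})"
  proof (rule finite_measure_mono)
    show "{\<omega> \<in> space M. x < (\<Sum>i\<in>I. X i \<omega>)} \<subseteq> (\<Union>i\<in>I. {\<omega> \<in> space M. x / card I < X i \<omega>})"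
    proof (rule ccontr)
      assume "\<not> ?thesis"
      then obtain \<omega> where \<omega>: "x < (\<Sum>i\<in>I. X i \<omega>)" "\<And>i. i \<in> I \<Longrightarrow> X i \<omega> \<le> x / card I"
        by force
      have "(\<Sum>i\<in>I. X i \<omega>) \<le> (\<Sum>i\<in>I. x / card I)" using \<omega>(2) by (rule sum_mono)
      also have "\<dots> = x" using card by simp
      finally show False using \<omega>(1) by simp
    qed
    show "(\<Union>i\<in>I. {\<omega> \<in> space M. x / card I < X i \<omega>}) \<in> events"
      using assms(1) rv by (intro sets.finite_UN) auto
  qed
  also have "\<dots> \<le> (\<Sum>i\<in>I. prob {\<omega> \<in> space M. x / card I < X i \<omega>})"
    using assms(1) rv by (intro finite_measure_subadditive_finite) auto
  also have "\<dots> = (\<Sum>i\<in>I. tail (rv_df M (X i)) (x / card I))"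
    using rv by (intro sum.cong) (auto simp: tail_rv_df)
  finally show ?thesis .
qed

text \<open>
  The domination of the first tail \<open>g\<close> by \<open>s n\<close> is carried through the induction: it turns a summand
  with tail \<open>o(g)\<close> into one with tail \<open>o(s n)\<close>, a negligible perturbation of \<open>s n\<close>.
\<close>

lemma tail_partial_sum_decay:
  fixes \<xi> :: "nat \<Rightarrow> 'a \<Rightarrow> real"
  assumes indep: "indep_vars (\<lambda>_. borel) \<xi> {1..}"
    and C1: "consistently_varying (rv_df M (\<xi> 1))"
    and Ck: "\<And>k. k \<ge> 2 \<Longrightarrow> consistently_varying (rv_df M (\<xi> k)) \<or>
           tail (rv_df M (\<xi> k)) \<in> o[at_top](tail (rv_df M (\<xi> 1)))"
    and n: "1 \<le> n"
  defines "s \<equiv> (\<lambda>n. tail (rv_df M (\<lambda>\<omega>. \<Sum>k = 1..n. \<xi> k \<omega>)))"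
  shows "consistent_decay (s n) \<and> (\<forall>x. 0 < s n x) \<and> tail (rv_df M (\<xi> 1)) \<in> O[at_top](s n)"
  using n
proof (induction n rule: dec_induct)
  case base
  have "random_variable borel (\<xi> 1)" using indep by (auto simp: indep_vars_def)
  with C1 show ?case
    by (simp add: s_def consistently_varying_iff_consistent_decay[OF antimono_tail_rv_df])
next
  case (step n)
  define g where "g = tail (rv_df M (\<xi> 1))"
  define S where "S = (\<lambda>\<omega>. \<Sum>k = 1..n. \<xi> k \<omega>)"
  define h where "h = tail (rv_df M (\<xi> (Suc n)))"
  have rv: "random_variable borel (\<xi> k)" if "1 \<le> k" for k
    using indep that by (auto simp: indep_vars_def)
  have rvS: "random_variable borel S" unfolding S_def using rv by simp
  have s_S: "s n = tail (rv_df M S)" by (simp add: s_def S_def)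
  have s_Suc: "s (Suc n) = tail (rv_df M (\<lambda>\<omega>. \<xi> (Suc n) \<omega> + S \<omega>))"
    by (simp add: s_def S_def add.commute)
  have IH: "consistent_decay (s n)" "\<And>x. 0 < s n x" "g \<in> O[at_top](s n)"
    using step.IH by (auto simp: g_def)
  have mono: "antimono (s n)" "antimono h"
    unfolding s_S h_def using rvS rv by (auto intro!: antimono_tail_rv_df)
  have h0: "0 \<le> h x" for x unfolding h_def using rv by (intro tail_rv_df_bounds) auto
  have ind: "indep_var borel (\<xi> (Suc n)) borel S"
    unfolding S_def by (intro indep_vars_sum indep_vars_subset[OF indep]) auto
  have "consistent_decay (\<lambda>x. s n x + h x)"
  proof (cases "consistently_varying (rv_df M (\<xi> (Suc n)))")
    case True
    then have "consistent_decay h"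
      unfolding h_def using rv
      by (subst (asm) consistently_varying_iff_consistent_decay[OF antimono_tail_rv_df]) auto
    then show ?thesis by (intro consistent_decay_add IH mono)
  next
    case False
    then have "h \<in> o[at_top](g)" using Ck[of "Suc n"] step.hyps by (simp add: h_def g_def)
    then have "h \<in> o[at_top](s n)" using IH(3) by (rule landau_o.small_big_trans)
    then show ?thesis by (intro consistent_decay_add_smallo IH h0)
  qed
  then have dec: "consistent_decay (\<lambda>x. h x + s n x)" by (simp add: add.commute)
  have "0 < h x + s n x" for x using h0 IH(2) by (rule add_nonneg_pos)
  note asymp = tail_add_asymp[OF ind, folded s_S h_def s_Suc, OF dec this]
  have rvSuc: "random_variable borel (\<lambda>\<omega>. \<xi> (Suc n) \<omega> + S \<omega>)" using rvS rv by simp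
  have "consistent_decay (s (Suc n))"
    by (rule consistent_decay_asymp[OF dec])
      (use asymp tail_rv_df_bounds[OF rvSuc] in \<open>auto simp: s_Suc\<close>)
  moreover have half: "\<forall>\<^sub>F x in at_top. s n x \<le> 2 * s (Suc n) x"
    using asymp(2)[of "1/2", simplified]
  proof eventually_elim
    case (elim x)
    then show ?case using h0[of x] by simp
  qed
  have "0 < s (Suc n) x" for x
  proof -
    obtain z where z: "s n z \<le> 2 * s (Suc n) z" "x \<le> z"
      using eventually_happens[OF eventually_conj[OF half eventually_ge_at_top[of x]]] by auto
    then have "0 < s (Suc n) z" using IH(2)[of z] by simp
    also have "\<dots> \<le> s (Suc n) x"
      unfolding s_Suc using antimonoD[OF antimono_tail_rv_df[OF rvSuc] z(2)] .
    finally show ?thesis .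
  qed
  moreover have "g \<in> O[at_top](s (Suc n))"
  proof -
    have "s n \<in> O[at_top](s (Suc n))"
    proof (rule bigoI)
      show "\<forall>\<^sub>F x in at_top. norm (s n x) \<le> 2 * norm (s (Suc n) x)"
        using half by eventually_elim (use IH(2) \<open>\<And>x. 0 < s (Suc n) x\<close> in \<open>simp add: abs_of_pos\<close>)
    qed
    with IH(3) show ?thesis by (rule landau_o.big_trans)
  qed
  ultimately show ?case by (simp add: g_def)
qed

text \<open>
  The power bound for \<open>g\<close> holds from some \<open>z\<close> on. If \<open>x / n \<ge> z\<close>, the union bound and the average
  condition apply at \<open>x / n\<close>, with \<open>n * n powr q \<le> n powr (p + 1)\<close>. Otherwise \<open>x \<le> z * n\<close>, and the
  power bound from \<open>z\<close> to \<open>z * n\<close> shows that the right-hand side is at least \<open>1\<close>.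
\<close>

lemma tail_partial_sum_uniform_bound:
  fixes \<xi> :: "nat \<Rightarrow> 'a \<Rightarrow> real"
  assumes rv: "\<And>k. 1 \<le> k \<Longrightarrow> random_variable borel (\<xi> k)"
    and mono: "antimono g" and pos: "\<And>x. 0 < g x"
    and q: "q \<in> decay_exponents g" "q \<le> p"
    and avg: "\<forall>\<^sub>F x in at_top. \<forall>n\<ge>1. (\<Sum>i = 1..n. tail (rv_df M (\<xi> i)) x) \<le> B * (real n * g x)"
  shows "\<exists>C. \<forall>\<^sub>F x in at_top. \<forall>n.
    tail (rv_df M (\<lambda>\<omega>. \<Sum>k = 1..n. \<xi> k \<omega>)) x \<le> C * real n powr (p + 1) * g x"
proof -
  obtain c x0 where c: "0 < c" "0 < x0"
    "\<And>x t. x0 \<le> x \<Longrightarrow> 1 \<le> t \<Longrightarrow> c * t powr (-q) * g x \<le> g (x * t)"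
    using decay_exponents_power_bound[OF mono pos q(1)] by metis
  have q0: "0 \<le> q" using q(1) by (simp add: decay_exponents_def)
  obtain x1 where x1: "\<And>x n. x1 \<le> x \<Longrightarrow> 1 \<le> n \<Longrightarrow>
      (\<Sum>i = 1..n. tail (rv_df M (\<xi> i)) x) \<le> B * (real n * g x)"
    using avg unfolding eventually_at_top_linorder by blast
  define z where "z = max x0 x1"
  have z: "x0 \<le> z" "x1 \<le> z" "0 < z" using c(2) by (auto simp: z_def)
  define C where "C = max B 0 / c + 1 / (c * g z)"
  have C0: "0 \<le> max B 0 / c" "0 \<le> 1 / (c * g z)" using c(1) pos[of z] by auto
  have scale: "g x \<le> (1 / c) * t powr q * g (x * t)" if "z \<le> x" "1 \<le> t" for x t
  proof -
    have "c * t powr (-q) * g x \<le> g (x * t)" using c(3) that z by simp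
    then show ?thesis using c(1) that by (simp add: powr_minus field_simps)
  qed
  have "tail (rv_df M (\<lambda>\<omega>. \<Sum>k = 1..n. \<xi> k \<omega>)) x \<le> C * real n powr (p + 1) * g x"
    if x: "z \<le> x" for n x
  proof (cases "n = 0")
    case True
    then show ?thesis using x z by (simp add: tail_rv_df)
  next
    case False
    then have n: "1 \<le> n" "1 \<le> real n" by simp_all
    have pw: "real n * real n powr q \<le> real n powr (p + 1)" "real n powr q \<le> real n powr (p + 1)"
    proof -
      have "real n * real n powr q = real n powr (q + 1)" using n by (simp add: powr_add)
      also have "\<dots> \<le> real n powr (p + 1)" using n q by (intro powr_mono) auto
      finally show "real n * real n powr q \<le> real n powr (p + 1)" .
      show "real n powr q \<le> real n powr (p + 1)" using n q by (intro powr_mono) auto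
    qed
    have rvn: "random_variable borel (\<xi> k)" if "k \<in> {1..n}" for k using rv that by simp
    show ?thesis
    proof (cases "z \<le> x / n")
      case True
      have "tail (rv_df M (\<lambda>\<omega>. \<Sum>k = 1..n. \<xi> k \<omega>)) x \<le> (\<Sum>i = 1..n. tail (rv_df M (\<xi> i)) (x / n))"
        using tail_sum_le[of "{1..n}" \<xi> x] n rvn by simp
      also have "\<dots> \<le> B * (real n * g (x / n))" using x1[OF _ n(1)] True z by simp
      also have "\<dots> \<le> max B 0 * (real n * g (x / n))"
        using pos[of "x / n"] by (intro mult_right_mono) auto
      also have "\<dots> \<le> max B 0 * (real n * ((1 / c) * real n powr q * g x))"
        using scale[OF True n(2)] n by (intro mult_left_mono) auto
      also have "\<dots> = max B 0 / c * (real n * real n powr q) * g x" by simp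
      also have "\<dots> \<le> max B 0 / c * real n powr (p + 1) * g x"
        using pw(1) pos[of x] C0 by (intro mult_right_mono mult_left_mono) auto
      also have "\<dots> \<le> C * real n powr (p + 1) * g x"
        using pos[of x] C0 unfolding C_def by (intro mult_right_mono) auto
      finally show ?thesis .
    next
      case False
      then have "x \<le> z * n" using n by (simp add: field_simps)
      have "g z \<le> (1 / c) * real n powr q * g (z * n)" using scale[OF _ n(2)] by simp
      also have "\<dots> \<le> (1 / c) * real n powr q * g x"
        using c(1) antimonoD[OF mono \<open>x \<le> z * n\<close>] by (intro mult_left_mono) auto
      finally have "1 \<le> 1 / (c * g z) * real n powr q * g x"
        using pos[of z] c(1) by (simp add: field_simps)
      also have "\<dots> \<le> 1 / (c * g z) * real n powr (p + 1) * g x"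
        using pw(2) pos[of x] C0 by (intro mult_right_mono mult_left_mono) auto
      also have "\<dots> \<le> C * real n powr (p + 1) * g x"
        using pos[of x] C0 unfolding C_def by (intro mult_right_mono) auto
      finally have "1 \<le> C * real n powr (p + 1) * g x" .
      moreover have "tail (rv_df M (\<lambda>\<omega>. \<Sum>k = 1..n. \<xi> k \<omega>)) x \<le> 1"
        using rvn by (intro tail_rv_df_bounds) simp
      ultimately show ?thesis by simp
    qed
  qed
  then show ?thesis unfolding eventually_at_top_linorder by blast
qed

section \<open>The random sum\<close>

lemma prob_counting_sums_one:
  assumes \<eta>: "\<eta> \<in> measurable M (count_space UNIV)"
  shows "(\<lambda>n::nat. prob {\<omega> \<in> space M. \<eta> \<omega> = n}) sums 1"
proof -
  have "(\<lambda>n. prob {\<omega> \<in> space M. \<eta> \<omega> = n}) sums prob (\<Union>n. {\<omega> \<in> space M. \<eta> \<omega> = n})"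
    using \<eta> by (intro finite_measure_UNION) (auto simp: disjoint_family_on_def)
  also have "(\<Union>n. {\<omega> \<in> space M. \<eta> \<omega> = n}) = space M" by auto
  finally show ?thesis by (simp add: prob_space)
qed

text \<open>
  The partial sums are the expectations of \<open>\<eta> powr a\<close> restricted to \<open>\<eta> < N\<close>.
\<close>

lemma summable_prob_powr:
  assumes \<eta>: "\<eta> \<in> measurable M (count_space UNIV)"
    and int: "integrable M (\<lambda>\<omega>. real (\<eta> \<omega>) powr a)"
  shows "summable (\<lambda>n. prob {\<omega> \<in> space M. \<eta> \<omega> = n} * real n powr a)"
proof (rule summableI_nonneg_bounded)
  let ?A = "\<lambda>n. {\<omega> \<in> space M. \<eta> \<omega> = n}"
  have A: "?A n \<in> events" for n using \<eta> by simp
  have I: "integrable M (indicat_real (?A n))" for n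
    using A by (intro integrable_real_indicator) (auto simp: less_top[symmetric])
  fix N :: nat
  show "0 \<le> prob (?A N) * real N powr a" by simp
  have "(\<Sum>n<N. prob (?A n) * real n powr a) = (\<integral>\<omega>. (\<Sum>n<N. indicator (?A n) \<omega> * real n powr a) \<partial>M)"
    using A I by (subst Bochner_Integration.integral_sum) auto
  also have "\<dots> \<le> (\<integral>\<omega>. real (\<eta> \<omega>) powr a \<partial>M)"
  proof (rule integral_mono[OF _ int])
    show "integrable M (\<lambda>\<omega>. \<Sum>n<N. indicator (?A n) \<omega> * real n powr a)"
      using I by (intro Bochner_Integration.integrable_sum integrable_mult_left) auto
    fix \<omega> assume "\<omega> \<in> space M"
    then have "(\<Sum>n<N. indicator (?A n) \<omega> * real n powr a)
        = (\<Sum>n<N. if n = \<eta> \<omega> then real n powr a else 0)"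
      by (intro sum.cong) (auto simp: indicator_def)
    also have "\<dots> \<le> real (\<eta> \<omega>) powr a" by (simp add: sum.delta)
    finally show "(\<Sum>n<N. indicator (?A n) \<omega> * real n powr a) \<le> real (\<eta> \<omega>) powr a" .
  qed
  finally show "(\<Sum>n<N. prob (?A n) * real n powr a) \<le> (\<integral>\<omega>. real (\<eta> \<omega>) powr a \<partial>M)" .
qed

lemma random_variable_random_sum:
  assumes "\<And>k. 1 \<le> k \<Longrightarrow> random_variable borel (\<xi> k)" and \<eta>: "\<eta> \<in> measurable M (count_space UNIV)"
  shows "random_variable borel (random_sum \<xi> \<eta>)"
proof -
  have "(\<lambda>\<omega>. \<Sum>k = 1..n. \<xi> k \<omega>) \<in> borel_measurable M" for n
    using assms(1) by (intro borel_measurable_sum) auto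
  from measurable_compose_countable[where f = "\<lambda>n \<omega>. \<Sum>k = 1..n. \<xi> k \<omega>", OF this \<eta>]
  show ?thesis unfolding random_sum_def[abs_def] .
qed

text \<open>
  The event that the first \<open>n\<close> variables sum to more than \<open>x\<close> is the preimage, under the
  whole sequence, of a measurable set of sequences, hence independent of the event \<open>\<eta> = n\<close>.
\<close>

lemma tail_random_sum_sums:
  assumes rv: "\<And>k. 1 \<le> k \<Longrightarrow> random_variable borel (\<xi> k)"
    and indep: "independent_rvs M (count_space UNIV) \<eta>
           (\<Pi>\<^sub>M k\<in>{1..}. borel) (\<lambda>\<omega>. \<lambda>k\<in>{1..}. \<xi> k \<omega>)"
  shows "(\<lambda>n. prob {\<omega> \<in> space M. \<eta> \<omega> = n} * tail (rv_df M (\<lambda>\<omega>. \<Sum>k = 1..n. \<xi> k \<omega>)) x)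
    sums tail (rv_df M (random_sum \<xi> \<eta>)) x"
proof -
  define P where "P = (\<Pi>\<^sub>M k\<in>{1::nat..}. (borel :: real measure))"
  define \<Xi> where "\<Xi> = (\<lambda>\<omega>. \<lambda>k\<in>{1..}. \<xi> k \<omega>)"
  have \<eta>: "\<eta> \<in> measurable M (count_space UNIV)" and "\<Xi> \<in> measurable M P"
    and ind: "indep_set (sets (vimage_algebra (space M) \<eta> (count_space UNIV)))
       (sets (vimage_algebra (space M) \<Xi> P))"
    using indep unfolding independent_rvs_def P_def \<Xi>_def by auto
  let ?A = "\<lambda>n. {\<omega> \<in> space M. \<eta> \<omega> = n}" and ?B = "\<lambda>n. {\<omega> \<in> space M. x < (\<Sum>k = 1..n. \<xi> k \<omega>)}"
  have rvS: "random_variable borel (\<lambda>\<omega>. \<Sum>k = 1..n. \<xi> k \<omega>)" for n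
    using rv by (intro borel_measurable_sum) auto
  then have B: "?B n \<in> events" for n by simp
  have A: "?A n \<in> events" for n using \<eta> by simp
  have joint: "prob (?A n \<inter> ?B n) = prob (?A n) * tail (rv_df M (\<lambda>\<omega>. \<Sum>k = 1..n. \<xi> k \<omega>)) x" for n
  proof -
    have "?A n = \<eta> -` {n} \<inter> space M" by auto
    then have 1: "?A n \<in> sets (vimage_algebra (space M) \<eta> (count_space UNIV))"
      by (simp add: in_vimage_algebra)
    have "{f \<in> space P. x < (\<Sum>k = 1..n. f k)} \<in> sets P"
    proof -
      have "(\<lambda>f. f k) \<in> borel_measurable P" if "k \<in> {1..n}" for k
        unfolding P_def using that by (intro measurable_component_singleton) auto
      then have "(\<lambda>f. \<Sum>k = 1..n. f k) \<in> borel_measurable P" by (intro borel_measurable_sum) auto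
      then show ?thesis by simp
    qed
    moreover have "?B n = \<Xi> -` {f \<in> space P. x < (\<Sum>k = 1..n. f k)} \<inter> space M"
      using measurable_space[OF \<open>\<Xi> \<in> measurable M P\<close>] by (auto simp: \<Xi>_def)
    ultimately have 2: "?B n \<in> sets (vimage_algebra (space M) \<Xi> P)"
      by (simp only: in_vimage_algebra)
    show ?thesis using indep_setD[OF ind 1 2] by (simp only: tail_rv_df[OF rvS])
  qed
  have "(\<lambda>n. prob (?A n \<inter> ?B n)) sums prob (\<Union>n. ?A n \<inter> ?B n)"
    using A B by (intro finite_measure_UNION) (auto simp: disjoint_family_on_def)
  also have "(\<Union>n. ?A n \<inter> ?B n) = {\<omega> \<in> space M. x < random_sum \<xi> \<eta> \<omega>}"
    by (auto simp: random_sum_def)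
  also have "prob \<dots> = tail (rv_df M (random_sum \<xi> \<eta>)) x"
    using random_variable_random_sum[OF rv \<eta>] by (simp add: tail_rv_df)
  finally show ?thesis by (simp only: joint)
qed

end

theorem theorem6:
  fixes M :: "'a measure" and \<xi> :: "nat \<Rightarrow> 'a \<Rightarrow> real" and \<eta> :: "'a \<Rightarrow> nat"
  assumes "prob_space M"
    and "prob_space.indep_vars M (\<lambda>_. borel) \<xi> {1..}"
    and "\<eta> \<in> measurable M (count_space UNIV)"
    and "measure M {\<omega> \<in> space M. \<eta> \<omega> = 0} < 1"
    and "independent_rvs M (count_space UNIV) \<eta>
           (\<Pi>\<^sub>M k\<in>{1..}. borel) (\<lambda>\<omega>. \<lambda>k\<in>{1..}. \<xi> k \<omega>)"
    and "consistently_varying (rv_df M (\<xi> 1))"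
    and "\<And>k. k \<ge> 2 \<Longrightarrow> consistently_varying (rv_df M (\<xi> k)) \<or>
           tail (rv_df M (\<xi> k)) \<in> o[at_top](tail (rv_df M (\<xi> 1)))"
    and "Limsup at_top (\<lambda>x::real. SUP n\<in>{1::nat..}.
           ereal (1 / (real n * tail (rv_df M (\<xi> 1)) x) *
             (\<Sum>i = 1..n. tail (rv_df M (\<xi> i)) x))) < \<infinity>"
    and "\<exists>p::real. ereal p > upper_Matuszewska_index (rv_df M (\<xi> 1)) \<and>
           integrable M (\<lambda>\<omega>. real (\<eta> \<omega>) powr (p + 1))"
  shows "consistently_varying (rv_df M (random_sum \<xi> \<eta>))"
proof -
  interpret prob_space M by fact
  define g where "g = tail (rv_df M (\<xi> 1))"
  define s where "s = (\<lambda>n. tail (rv_df M (\<lambda>\<omega>. \<Sum>k = 1..n. \<xi> k \<omega>)))"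
  define \<pi> where "\<pi> = (\<lambda>n. prob {\<omega> \<in> space M. \<eta> \<omega> = n})"
  define T where "T = tail (rv_df M (random_sum \<xi> \<eta>))"
  note indep = assms(2) and \<eta> = assms(3)
  have rv: "random_variable borel (\<xi> k)" if "1 \<le> k" for k
    using indep that by (auto simp: indep_vars_def)
  have rvS: "random_variable borel (\<lambda>\<omega>. \<Sum>k = 1..n. \<xi> k \<omega>)" for n
    using rv by (intro borel_measurable_sum) auto
  have mono: "antimono g" unfolding g_def using rv by (intro antimono_tail_rv_df) simp
  have pos: "\<And>x. 0 < g x" and dec: "consistent_decay g"
    using assms(6) mono unfolding g_def by (auto simp: consistently_varying_iff_consistent_decay)
  have T: "(\<lambda>n. \<pi> n * s n x) sums T x" for x
    unfolding \<pi>_def s_def T_def by (rule tail_random_sum_sums[OF rv assms(5)])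
  have rvT: "random_variable borel (random_sum \<xi> \<eta>)"
    by (rule random_variable_random_sum[OF rv \<eta>])
  have s_dec: "consistent_decay (s n)" "\<And>x. 0 < s n x" "g \<in> O[at_top](s n)" if "1 \<le> n" for n
    using tail_partial_sum_decay[OF indep assms(6,7) that] by (auto simp: s_def g_def)
  have s_bounds: "0 \<le> s n x" "s n x \<le> 1" and s_mono: "antimono (s n)" for n x
    unfolding s_def using tail_rv_df_bounds[OF rvS] antimono_tail_rv_df[OF rvS] by auto
  \<comment> \<open>The empty sum is \<open>0\<close>, so the term with index \<open>0\<close> vanishes on nonnegative arguments.\<close>
  have s0: "s 0 x = 0" if "0 \<le> x" for x
    unfolding s_def using that by (simp add: tail_rv_df)
  have "consistent_decay (s 0)"
    unfolding consistent_decay_def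
  proof (intro allI impI exI[of _ "1/2"] conjI)
    fix e :: real assume "0 < e"
    show "\<forall>\<^sub>F x in at_top. s 0 (x * (1 / 2)) \<le> (1 + e) * s 0 x"
      using eventually_ge_at_top[of 0] by eventually_elim (simp add: s0)
  qed simp_all
  with s_dec(1) have s_dec0: "consistent_decay (s n)" for n by (cases "n = 0") auto
  obtain k where k: "1 \<le> k" "0 < \<pi> k"
  proof -
    have "\<exists>k\<ge>1. \<pi> k \<noteq> 0"
    proof (rule ccontr)
      assume "\<not> ?thesis"
      then have "\<pi> n = 0" if "n \<notin> {0}" for n using that by auto
      then have "\<pi> sums (\<Sum>n\<in>{0}. \<pi> n)" by (intro sums_finite) auto
      then have "\<pi> sums \<pi> 0" by simp
      moreover have "\<pi> sums 1" unfolding \<pi>_def by (rule prob_counting_sums_one[OF \<eta>])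
      ultimately have "\<pi> 0 = 1" by (rule sums_unique2)
      with assms(4) show False by (simp add: \<pi>_def)
    qed
    then show ?thesis using that by (auto simp: \<pi>_def zero_less_measure_iff)
  qed
  obtain p where p: "upper_Matuszewska_index (rv_df M (\<xi> 1)) < ereal p"
    and int: "integrable M (\<lambda>\<omega>. real (\<eta> \<omega>) powr (p + 1))"
    using assms(9) by blast
  obtain q where q: "q \<in> decay_exponents g" "q \<le> p"
  proof -
    have "Inf (decay_exponents g) < p"
      using p upper_Matuszewska_index_eq_Inf[of "rv_df M (\<xi> 1)", folded g_def, OF mono pos dec] by simp
    moreover have "bdd_below (decay_exponents g)"
      by (auto simp: bdd_below_def decay_exponents_def)
    ultimately show ?thesis
      using that decay_exponents_nonempty[OF dec] by (auto simp: cInf_less_iff intro: less_imp_le)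
  qed
  obtain B :: real where B: "\<forall>\<^sub>F x in at_top. \<forall>n\<ge>1.
      (\<Sum>i = 1..n. tail (rv_df M (\<xi> i)) x) \<le> B * (real n * g x)"
  proof -
    define m where "m = (\<lambda>x. SUP n\<in>{1::nat..}.
      ereal (1 / (real n * g x) * (\<Sum>i = 1..n. tail (rv_df M (\<xi> i)) x)))"
    have "Limsup at_top m < \<infinity>" using assms(8) unfolding m_def g_def .
    then obtain B where "Limsup at_top m < ereal B" using ereal_dense2 by blast
    from Limsup_lessD[OF this]
    have "\<forall>\<^sub>F x in at_top. \<forall>n\<ge>1. (\<Sum>i = 1..n. tail (rv_df M (\<xi> i)) x) \<le> B * (real n * g x)"
    proof eventually_elim
      case (elim x)
      show ?case
      proof (intro allI impI)
        fix n :: nat assume n: "1 \<le> n"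
        have "ereal (1 / (real n * g x) * (\<Sum>i = 1..n. tail (rv_df M (\<xi> i)) x)) \<le> m x"
          unfolding m_def using n by (intro SUP_upper) simp
        also note elim
        finally have "1 / (real n * g x) * (\<Sum>i = 1..n. tail (rv_df M (\<xi> i)) x) < B" by simp
        moreover have "0 < real n * g x" using n pos by simp
        ultimately show "(\<Sum>i = 1..n. tail (rv_df M (\<xi> i)) x) \<le> B * (real n * g x)"
          by (simp add: divide_less_eq less_imp_le)
      qed
    qed
    then show ?thesis by (rule that)
  qed
  have "\<exists>C. \<forall>\<^sub>F x in at_top. \<forall>n. s n x \<le> C * real n powr (p + 1) * g x"
    unfolding s_def by (rule tail_partial_sum_uniform_bound[OF rv mono pos q B])
  then obtain C where dom: "\<forall>\<^sub>F x in at_top. \<forall>n. s n x \<le> C * real n powr (p + 1) * g x"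
    by blast
  have "summable (\<lambda>n. \<pi> n * (C * real n powr (p + 1)))"
    using summable_mult[OF summable_prob_powr[OF \<eta> int], of C] by (simp add: \<pi>_def mult_ac)
  moreover have "0 \<le> \<pi> n" for n by (simp add: \<pi>_def)
  ultimately have "consistent_decay T"
    using consistent_decay_mixture[where s = s and w = "\<lambda>n. C * real n powr (p + 1)", OF dec mono pos
        s_dec0 s_mono s_bounds(1) _ _ dom T k(2) s_dec(3)[OF k(1)]] by blast
  moreover have "0 < T x" for x
  proof -
    have "\<pi> k * s k x \<le> T x"
      using sum_le_suminf[OF sums_summable[OF T[of x]], of "{k}"] sums_unique[OF T[of x]] s_bounds
      by (simp add: \<pi>_def)
    moreover have "0 < \<pi> k * s k x" using k s_dec(2) by simp
    ultimately show ?thesis by simp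
  qed
  ultimately show ?thesis
    using consistently_varying_iff_consistent_decay[OF antimono_tail_rv_df[OF rvT]]
    by (simp add: T_def)
qed

end
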